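(* Let $n\ge1$ be an integer, let $c_1,\dots,c_n\in\mathbb C$ be distinct, let $B\subset\mathbb C$ be a domain not containing any $c_i$, let $\alpha\in\mathbb C$, and let $m_1,\dots,m_{n+2}\in\mathbb C\setminus\{0\}$ satisfy $$\sum_{i=1}^{n+2}\frac1{m_i}=n.$$ Then there exists a system of ordinary differential equations $$\frac{dx}{dt}=f_1(x,y),\qquad\frac{dy}{dt}=f_2(x,y),\qquad f_1,f_2\in\mathbb C(t)[x,y],$$ satisfying condition $(L)$ (see context) with respect to the Hirzebruch surface $\Sigma_n$, such that: (A1) the accessible singular points of the system on the boundary divisor $D^{(0)}\times B$ are exactly the $n+2$ points $z_2=c_1,\ \dots,\ z_2=c_n,\ z_2=t,\ z_2=\infty$, and each of them is simple; (A2) the ratio of the local index at $z_2=c_i$ is $m_i$ ($1\le i\le n$), at $z_2=t$ it is $m_{n+1}$, and at $z_2=\infty$ it is $m_{n+2}$.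
   Context: The surface $\Sigma_n$ is obtained by gluing four copies of $\mathbb C^2$ with coordinates $(z_j,w_j)$, $j=0,1,2,3$, via $z_0=x,\ w_0=y$; $z_1=1/x,\ w_1=-x^ny-\alpha x$; $z_2=z_0,\ w_2=1/w_0$; $z_3=z_1,\ w_3=1/w_1$. The boundary divisor is $D^{(0)}=\{w_2=0\}\cup\{w_3=0\}\cong\mathbb P^1$ (with $(D^{(0)})^2=n$); the point $z_2=\infty$ of $D^{(0)}$ is $(z_3,w_3)=(0,0)$. Condition $(L)$: the vector field $\frac{\partial}{\partial t}+f_1\frac{\partial}{\partial x}+f_2\frac{\partial}{\partial y}$ extends to a rational vector field in $H^0(\Sigma_n\times B,\Theta_{\Sigma_n\times B}(-\log D^{(0)})(D^{(0)}))$. Equivalently: (1) the system is polynomial in the coordinates $(z_1,w_1)$, and (2) in the coordinates $(X,Y)=(x,1/y)$ it has the form $\frac{dX}{dt}=\frac{F_1(X,Y)}{Y}$, $\frac{dY}{dt}=F_2(X,Y)$ with $F_1,F_2\in\mathbb C(t)[X,Y]$. Accessible singular points: near a point $z_2=c$ of $D^{(0)}$ (where $c$ is a constant or $c=t$) use $(X,Y)=(z_2-c,w_2)$, and near $z_2=\infty$ use $(X,Y)=(z_3,w_3)$. The system has the form $\frac{dX}{dt}=\frac{G(X,Y)}{Y}$, $\frac{dY}{dt}=H(X,Y)$ with $G,H$ polynomial in $X,Y$. The point is an accessible singular point if $G(0,0)=0$, and it is simple if $X=0$ is a zero of multiplicity one of $G(X,0)$. Writing $\frac{d}{dt}\binom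 XY=\frac1Y\left\{\begin{pmatrix}\lambda&*\\0&\mu\end{pmatrix}\binom XY+(\text{terms of order}\ge2)\right\}$, the local index is $(\lambda,\mu)$ and its ratio is $\lambda/\mu$. *)

theory Defs
  imports Complex_Main "HOL-Computational_Algebra.Computational_Algebra"
begin

section \<open>The rings $\mathbb{C}(t)$ and $\mathbb{C}(t)[X,Y]$\<close>

text \<open>
  The field $\mathbb{C}(t)$ is the fraction field of \<^typ>\<open>complex poly\<close>. In the nested polynomial
  type below the outer variable is the second one, i.e.
  $P = \sum_j (\sum_i r_{ij} X^i) Y^j$ with \<open>r\<^sub>i\<^sub>j = coeff (coeff P j) i\<close>.
\<close>

type_synonym ratfun = "complex poly fract"
type_synonym ratfun_poly2 = "ratfun poly poly"

text \<open>Regularity means that some representation has a denominator not vanishing at \<open>t\<close>. The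
  value at a pole is irrelevant.\<close>

definition ratfun_regular_at :: "ratfun \<Rightarrow> complex \<Rightarrow> bool" where
  "ratfun_regular_at r t \<longleftrightarrow> (\<exists>p q. r = Fract p q \<and> poly q t \<noteq> 0)"

definition ratfun_eval :: "ratfun \<Rightarrow> complex \<Rightarrow> complex" where
  "ratfun_eval r t =
     (if ratfun_regular_at r t
      then THE v. \<exists>p q. r = Fract p q \<and> poly q t \<noteq> 0 \<and> v = poly p t / poly q t
      else 0)"

definition regular_on :: "complex set \<Rightarrow> ratfun_poly2 \<Rightarrow> bool" where
  "regular_on B P \<longleftrightarrow> (\<forall>t\<in>B. \<forall>i j. ratfun_regular_at (coeff (coeff P j) i) t)"

definition at_time :: "ratfun_poly2 \<Rightarrow> complex \<Rightarrow> complex poly poly" where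
  "at_time P t = map_poly (map_poly (\<lambda>r. ratfun_eval r t)) P"

definition eval2 :: "ratfun_poly2 \<Rightarrow> complex \<Rightarrow> complex \<Rightarrow> complex \<Rightarrow> complex" where
  "eval2 P t X Y = poly (poly (at_time P t) [:Y:]) X"


section \<open>Derivative along the vector field $\partial_t + f_1\partial_x + f_2\partial_y$\<close>

text \<open>\<open>has_rate f\<^sub>1 f\<^sub>2 u t x y R\<close>: along the system, $du/dt = R$ at the point $(t,x,y)$.\<close>

definition has_rate ::
  "ratfun_poly2 \<Rightarrow> ratfun_poly2 \<Rightarrow> (complex \<Rightarrow> complex \<Rightarrow> complex \<Rightarrow> complex)
    \<Rightarrow> complex \<Rightarrow> complex \<Rightarrow> complex \<Rightarrow> complex \<Rightarrow> bool" where
  "has_rate f1 f2 u t x y R \<longleftrightarrow>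
     ((\<lambda>s. u (t + s) (x + s * eval2 f1 t x y) (y + s * eval2 f2 t x y))
        has_field_derivative R) (at 0)"


section \<open>The surface $\Sigma_n$ and condition (L)\<close>

text \<open>The charts are $(x,y)$, $(z_1,w_1)$, $(x,1/y)$ and $(z_1,1/w_1)$.\<close>

definition z1 :: "complex \<Rightarrow> complex \<Rightarrow> complex" where
  "z1 x y = 1 / x"

definition w1 :: "nat \<Rightarrow> complex \<Rightarrow> complex \<Rightarrow> complex \<Rightarrow> complex" where
  "w1 n \<alpha> x y = - (x ^ n) * y - \<alpha> * x"

text \<open>
  The coefficients are required to have no poles on \<open>B\<close>, because (L) asks for a section over
  $\Sigma_n \times B$. The three groups of conditions concern the charts $(x,y)$, $(z_1,w_1)$ and
  $(X,Y) = (x,1/y)$. They cover $\Sigma_n \times B$ up to codimension two, so nothing has to be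
  imposed in the fourth chart.
\<close>

definition condition_L ::
  "complex set \<Rightarrow> nat \<Rightarrow> complex \<Rightarrow> ratfun_poly2 \<Rightarrow> ratfun_poly2 \<Rightarrow> bool" where
  "condition_L B n \<alpha> f1 f2 \<longleftrightarrow>
     regular_on B f1 \<and> regular_on B f2 \<and>
     (\<exists>g1 g2. regular_on B g1 \<and> regular_on B g2 \<and>
        (\<forall>t\<in>B. \<forall>x y. x \<noteq> 0 \<longrightarrow>
           has_rate f1 f2 (\<lambda>_. z1) t x y (eval2 g1 t (z1 x y) (w1 n \<alpha> x y)) \<and>
           has_rate f1 f2 (\<lambda>_. w1 n \<alpha>) t x y (eval2 g2 t (z1 x y) (w1 n \<alpha> x y)))) \<and>
     (\<exists>F1 F2. regular_on B F1 \<and> regular_on B F2 \<and>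
        (\<forall>t\<in>B. \<forall>x y. y \<noteq> 0 \<longrightarrow>
           has_rate f1 f2 (\<lambda>_ x y. x) t x y (eval2 F1 t x (1 / y) / (1 / y)) \<and>
           has_rate f1 f2 (\<lambda>_ x y. 1 / y) t x y (eval2 F2 t x (1 / y))))"


section \<open>Accessible singular points and local indices\<close>

text \<open>
  A point of $D^{(0)}$, possibly moving with \<open>t\<close>: \<open>Finite_Pt c\<close> is $z_2 = c(t)$, used with \<open>c\<close>
  constant or \<open>c\<close> the identity, and \<open>Infinite_Pt\<close> is $z_2 = \infty$, i.e. $(z_3,w_3) = (0,0)$.
\<close>

datatype boundary_pt = Finite_Pt "complex \<Rightarrow> complex" | Infinite_Pt

fun loc_X :: "boundary_pt \<Rightarrow> complex \<Rightarrow> complex \<Rightarrow> complex \<Rightarrow> complex" where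
  "loc_X (Finite_Pt c) t x y = x - c t"
| "loc_X Infinite_Pt t x y = z1 x y"

fun loc_Y :: "nat \<Rightarrow> complex \<Rightarrow> boundary_pt \<Rightarrow> complex \<Rightarrow> complex \<Rightarrow> complex \<Rightarrow> complex" where
  "loc_Y n \<alpha> (Finite_Pt c) t x y = 1 / y"
| "loc_Y n \<alpha> Infinite_Pt t x y = 1 / w1 n \<alpha> x y"

fun loc_dom :: "nat \<Rightarrow> complex \<Rightarrow> boundary_pt \<Rightarrow> complex \<Rightarrow> complex \<Rightarrow> bool" where
  "loc_dom n \<alpha> (Finite_Pt c) x y \<longleftrightarrow> y \<noteq> 0"
| "loc_dom n \<alpha> Infinite_Pt x y \<longleftrightarrow> x \<noteq> 0 \<and> w1 n \<alpha> x y \<noteq> 0"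

text \<open>
  In the local coordinates $(X,Y)$ at \<open>p\<close> the system reads $dX/dt = G(X,Y)/Y$, $dY/dt = H(X,Y)$.
  The polynomials \<open>G\<close> and \<open>H\<close> are determined by the system when \<open>B\<close> is open and nonempty.
\<close>

definition local_form ::
  "complex set \<Rightarrow> nat \<Rightarrow> complex \<Rightarrow> ratfun_poly2 \<Rightarrow> ratfun_poly2 \<Rightarrow> boundary_pt
    \<Rightarrow> ratfun_poly2 \<Rightarrow> ratfun_poly2 \<Rightarrow> bool" where
  "local_form B n \<alpha> f1 f2 p G H \<longleftrightarrow>
     regular_on B G \<and> regular_on B H \<and>
     (\<forall>t\<in>B. \<forall>x y. loc_dom n \<alpha> p x y \<longrightarrow>
        has_rate f1 f2 (loc_X p) t x y
          (eval2 G t (loc_X p t x y) (loc_Y n \<alpha> p t x y) / loc_Y n \<alpha> p t x y) \<and>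
        has_rate f1 f2 (loc_Y n \<alpha> p) t x y
          (eval2 H t (loc_X p t x y) (loc_Y n \<alpha> p t x y)))"

text \<open>
  All notions are taken pointwise in \<open>t\<close>: they concern the point of $D^{(0)} \times B$ which the
  section \<open>p\<close> takes at time \<open>t\<close>.
\<close>

definition accessible_singular ::
  "complex set \<Rightarrow> nat \<Rightarrow> complex \<Rightarrow> ratfun_poly2 \<Rightarrow> ratfun_poly2 \<Rightarrow> boundary_pt \<Rightarrow> complex \<Rightarrow> bool"
where
  "accessible_singular B n \<alpha> f1 f2 p t \<longleftrightarrow>
     (\<exists>G H. local_form B n \<alpha> f1 f2 p G H \<and> eval2 G t 0 0 = 0)"

text \<open>\<open>poly (at_time G t) 0\<close> is $G(X,0)$, a polynomial in $X$; \<^const>\<open>order\<close> is only meaningful for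
  nonzero polynomials.\<close>

definition simple_accessible_singular ::
  "complex set \<Rightarrow> nat \<Rightarrow> complex \<Rightarrow> ratfun_poly2 \<Rightarrow> ratfun_poly2 \<Rightarrow> boundary_pt \<Rightarrow> complex \<Rightarrow> bool"
where
  "simple_accessible_singular B n \<alpha> f1 f2 p t \<longleftrightarrow>
     (\<exists>G H. local_form B n \<alpha> f1 f2 p G H \<and> eval2 G t 0 0 = 0 \<and>
        poly (at_time G t) 0 \<noteq> 0 \<and> order 0 (poly (at_time G t) 0) = 1)"

text \<open>
  $d(X,Y)/dt = Y^{-1}(G,\,YH)$, and \<open>pCons 0 H\<close> is $YH$. The constant terms of $G$ and $YH$ vanish
  and their linear parts are $\lambda X + {*}Y$ and $0X + \mu Y$.
\<close>

definition has_local_index ::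
  "complex set \<Rightarrow> nat \<Rightarrow> complex \<Rightarrow> ratfun_poly2 \<Rightarrow> ratfun_poly2 \<Rightarrow> boundary_pt \<Rightarrow> complex
    \<Rightarrow> complex \<Rightarrow> complex \<Rightarrow> bool" where
  "has_local_index B n \<alpha> f1 f2 p t l u \<longleftrightarrow>
     (\<exists>G H. local_form B n \<alpha> f1 f2 p G H \<and>
        (let P = at_time G t; Q = at_time (pCons 0 H) t in
           coeff (coeff P 0) 0 = 0 \<and> coeff (coeff Q 0) 0 = 0 \<and>
           coeff (coeff P 0) 1 = l \<and>
           coeff (coeff Q 0) 1 = 0 \<and> coeff (coeff Q 1) 0 = u))"

definition local_index_ratio ::
  "complex set \<Rightarrow> nat \<Rightarrow> complex \<Rightarrow> ratfun_poly2 \<Rightarrow> ratfun_poly2 \<Rightarrow> boundary_pt \<Rightarrow> complex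
    \<Rightarrow> complex \<Rightarrow> bool" where
  "local_index_ratio B n \<alpha> f1 f2 p t m \<longleftrightarrow>
     (\<exists>l u. has_local_index B n \<alpha> f1 f2 p t l u \<and> u \<noteq> 0 \<and> l / u = m)"

end

theory Submission
  imports Defs
begin

text \<open>
  Write \<open>p\<^sub>i = c\<^sub>i\<close> for \<open>i \<le> n\<close> and \<open>p\<^sub>n\<^sub>+\<^sub>1 = t\<close>, and let \<open>a(x) = (x - p\<^sub>1) \<dots> (x - p\<^sub>n\<^sub>+\<^sub>1)\<close>. The system
  \[ x' = a y + b, \quad y' = A y^2 + C y \]
  with \<open>a\<close>, \<open>b\<close>, \<open>A\<close>, \<open>C\<close> polynomials in \<open>x\<close> and \<open>t\<close> reads \<open>X' = (a + b Y) / Y\<close>, \<open>Y' = - A - C Y\<close> in the chart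
  \<open>(X, Y) = (x, 1/y)\<close>. Its accessible singular points at finite distance are therefore the roots of
  \<open>a\<close>, and the local index at the root \<open>p\<^sub>i\<close> is \<open>(da/dx (p\<^sub>i), - A(p\<^sub>i))\<close>. Prescribing the ratios means
  prescribing \<open>A\<close> at the \<open>n + 1\<close> nodes \<open>p\<^sub>i\<close>, so \<open>A\<close> is taken to be the Lagrange interpolant
  \[ A(x) = - \sum_i \frac{1}{m_i} \prod_{j \neq i} (x - p_j), \]
  of degree at most \<open>n\<close> and with \<open>x\<^sup>n\<close>-coefficient \<open>- \<Sum>\<^sub>i 1/m\<^sub>i\<close>.

  In \<open>(z, w) = (z\<^sub>1, w\<^sub>1)\<close> let \<open>r(z) = z\<^sup>n\<^sup>+\<^sup>1 a(1/z)\<close> and \<open>s(z) = n r(z) + z\<^sup>n A(1/z)\<close>. The top order terms in \<open>w\<close> are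
  \<open>z r w\<close> in \<open>z'\<close> and \<open>- s w\<^sup>2\<close> in \<open>w'\<close>. Since \<open>r(0) = 1\<close>, the point at infinity is a simple accessible
  singular point with index \<open>(1, s(0))\<close>, and \<open>s(0) = n - \<Sum>\<^sub>i 1/m\<^sub>i\<close> with \<open>i \<le> n + 1\<close>. The relation
  between the \<open>m\<^sub>i\<close> says exactly that the ratio \<open>1/s(0)\<close> is \<open>m\<^sub>n\<^sub>+\<^sub>2\<close>.

  It remains to make \<open>z'\<close> and \<open>w'\<close> polynomial. For \<open>\<alpha> \<noteq> 0\<close> the substitution \<open>y = - z\<^sup>n w - \<alpha> z\<^sup>n\<^sup>-\<^sup>1\<close>
  creates poles at \<open>z = 0\<close>. They are of order at most two and disappear for a suitable
  quadratic monomial \<open>b\<close> and a suitable \<open>C\<close> of degree at most one in \<open>x\<close>; this is the calculation in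
  \<open>infinity_chart\<close>. Every coefficient is a polynomial in \<open>t\<close>, so no poles on \<open>B\<close> arise. By
  \<open>simple_singular_with_ratio\<close> one local form gives the simplicity and the ratio at a boundary point, and
  by \<open>local_form_unique\<close> it also suffices to exclude further accessible singular points.
\<close>

section \<open>Systems with coefficients polynomial in time\<close>

text \<open>The variables of the argument are, from the outermost to the innermost, \<open>Y\<close>, \<open>X\<close> and \<open>t\<close>. In
  this ring evaluation is a ring homomorphism everywhere, which \<^const>\<open>ratfun_eval\<close> is not.\<close>

definition lift :: "complex poly poly poly \<Rightarrow> ratfun_poly2" where
  "lift P = map_poly (map_poly to_fract) P"

definition eval_tx :: "complex poly poly \<Rightarrow> complex \<Rightarrow> complex \<Rightarrow> complex" where
  "eval_tx p t x = poly (poly p [:x:]) t"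

lemma ratfun_regular_to_fract: "ratfun_regular_at (to_fract p) t"
  unfolding ratfun_regular_at_def to_fract_def by (intro exI[of _ p] exI[of _ 1]) simp

lemma ratfun_eval_to_fract: "ratfun_eval (to_fract p) t = poly p t"
proof -
  have "(THE v. \<exists>a b. to_fract p = Fract a b \<and> poly b t \<noteq> 0 \<and> v = poly a t / poly b t) = poly p t"
  proof (rule the_equality)
    show "\<exists>a b. to_fract p = Fract a b \<and> poly b t \<noteq> 0 \<and> poly p t = poly a t / poly b t"
      unfolding to_fract_def by (intro exI[of _ p] exI[of _ 1]) simp
  next
    fix v
    assume "\<exists>a b. to_fract p = Fract a b \<and> poly b t \<noteq> 0 \<and> v = poly a t / poly b t"
    then obtain a b where ab: "Fract p 1 = Fract a b" "poly b t \<noteq> 0" "v = poly a t / poly b t"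
      unfolding to_fract_def by blast
    then have "b \<noteq> 0" by auto
    then have "p * b = a" using ab(1) by (simp add: eq_fract)
    then show "v = poly p t" using ab(2,3) by auto
  qed
  then show ?thesis
    by (simp add: ratfun_eval_def ratfun_regular_to_fract)
qed

lemma ratfun_eval_0 [simp]: "ratfun_eval 0 t = 0"
  using ratfun_eval_to_fract[of 0 t] by simp

lemma regular_on_lift: "regular_on B (lift P)"
  unfolding regular_on_def lift_def by (simp add: coeff_map_poly ratfun_regular_to_fract)

lemma at_time_pCons: "at_time (pCons p P) t = pCons (map_poly (\<lambda>r. ratfun_eval r t) p) (at_time P t)"
  unfolding at_time_def by (simp add: map_poly_pCons)

lemma eval2_pCons:
  "eval2 (pCons p P) t X Y = poly (map_poly (\<lambda>r. ratfun_eval r t) p) X + Y * eval2 P t X Y"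
  unfolding eval2_def at_time_pCons by simp

lemma eval2_0 [simp]: "eval2 0 t X Y = 0"
  by (simp add: eval2_def at_time_def)

lemma poly_eval_map_to_fract:
  "poly (map_poly (\<lambda>r. ratfun_eval r t) (map_poly to_fract p)) X = eval_tx p t X"
  unfolding eval_tx_def
  by (induction p) (simp_all add: map_poly_pCons ratfun_eval_to_fract)

text \<open>Repeated use of this rule reduces \<^const>\<open>eval2\<close> of a lifted polynomial, written as the list of
  its \<open>Y\<close>-coefficients, to scalar arithmetic.\<close>

lemma eval2_lift_pCons:
  "eval2 (lift (pCons p P)) t X Y = eval_tx p t X + Y * eval2 (lift P) t X Y"
  by (simp add: lift_def map_poly_pCons eval2_pCons poly_eval_map_to_fract)

lemma eval2_lift_0 [simp]: "eval2 (lift 0) t X Y = 0"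
  by (simp add: lift_def)

text \<open>Evaluation at a point \<open>X = u(t)\<close> that moves with time; this is what a translation of the
  origin to a moving boundary point requires.\<close>

lemma poly_poly_eq_eval_tx: "poly (poly p u) t = eval_tx p t (poly u t)"
  by (induction p) (simp_all add: eval_tx_def)

lemma eval_tx_simps [simp]:
  "eval_tx (p + q) t x = eval_tx p t x + eval_tx q t x"
  "eval_tx (p - q) t x = eval_tx p t x - eval_tx q t x"
  "eval_tx (- p) t x = - eval_tx p t x"
  "eval_tx (p * q) t x = eval_tx p t x * eval_tx q t x"
  "eval_tx (smult k p) t x = poly k t * eval_tx p t x"
  "eval_tx (pCons k p) t x = poly k t + x * eval_tx p t x"
  "eval_tx 0 t x = 0"
  "eval_tx 1 t x = 1"
  "eval_tx (numeral w) t x = numeral w"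
  by (simp_all add: eval_tx_def)

lemma eval_tx_shift [simp]: "eval_tx (pcompose p [:q, 1:]) t x = eval_tx p t (x + poly q t)"
  by (simp add: eval_tx_def[of "pcompose p _"] poly_pcompose poly_poly_eq_eval_tx add.commute)

lemma eval_tx_prod: "eval_tx (prod f I) t x = (\<Prod>i\<in>I. eval_tx (f i) t x)"
  by (simp add: eval_tx_def poly_prod)

lemma eval_tx_sum: "eval_tx (sum f I) t x = (\<Sum>i\<in>I. eval_tx (f i) t x)"
  by (simp add: eval_tx_def poly_sum)

section \<open>Rates of the coordinate functions\<close>

lemma has_rate_x: "has_rate f1 f2 (\<lambda>t x y. x - poly q t) t x y (eval2 f1 t x y - poly (pderiv q) t)"
  unfolding has_rate_def by (auto intro!: derivative_eq_intros)

lemma has_rate_inverse: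
  assumes "has_rate f1 f2 u t x y R" "u t x y \<noteq> 0"
  shows "has_rate f1 f2 (\<lambda>t x y. 1 / u t x y) t x y (- R / (u t x y)\<^sup>2)"
  using assms unfolding has_rate_def
  by (auto intro!: derivative_eq_intros simp: power2_eq_square)

lemma has_rate_y: "has_rate f1 f2 (\<lambda>t x y. y) t x y (eval2 f2 t x y)"
  unfolding has_rate_def by (auto intro!: derivative_eq_intros)

lemma has_rate_z1:
  "x \<noteq> 0 \<Longrightarrow> has_rate f1 f2 (\<lambda>_. z1) t x y (- eval2 f1 t x y / x\<^sup>2)"
  using has_rate_inverse[OF has_rate_x[of f1 f2 0 t x y]] by (simp add: z1_def [abs_def])

lemma has_rate_w1:
  "has_rate f1 f2 (\<lambda>_. w1 n \<alpha>) t x y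
     (- (of_nat n * x ^ (n - 1) * eval2 f1 t x y * y) - x ^ n * eval2 f2 t x y - \<alpha> * eval2 f1 t x y)"
  unfolding has_rate_def w1_def by (auto intro!: derivative_eq_intros simp: algebra_simps)

section \<open>Local forms at boundary points\<close>

lemma eval2_at_Y0:
  "eval2 G t X 0 = poly (poly (at_time G t) 0) X"
  by (simp add: eval2_def)

lemma eval2_eq_poly: "eval2 G t X Y = poly (map_poly (\<lambda>p. poly p X) (at_time G t)) Y"
proof -
  have "poly (poly P [:Y:]) X = poly (map_poly (\<lambda>p. poly p X) P) Y" for P :: "complex poly poly"
    by (induction P) (simp_all add: map_poly_pCons)
  then show ?thesis by (simp add: eval2_def)
qed

text \<open>Multiplying by the variable removes the excluded point: \<open>y p(y)\<close> and \<open>y q(y)\<close> also agree at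
  \<open>y = 0\<close>.\<close>

lemma poly_eqI_punctured:
  fixes p q :: "complex poly"
  assumes "\<And>y. y \<noteq> 0 \<Longrightarrow> poly p y = poly q y"
  shows "p = q"
proof -
  have "poly (pCons 0 p) = poly (pCons 0 q)" using assms by force
  then show ?thesis by (simp add: poly_eq_poly_eq_iff)
qed

lemma loc_coords_finite:
  "loc_X (Finite_Pt q) = (\<lambda>t x y. x - q t)" "loc_Y n \<alpha> (Finite_Pt q) = (\<lambda>t x y. 1 / y)"
  by (simp_all add: fun_eq_iff)

text \<open>The rate of \<open>X\<close> fixes \<open>G(X, Y)\<close> at each \<open>Y \<noteq> 0\<close>, and a polynomial in \<open>Y\<close> is determined by these
  values. Hence a single local form decides that a point is \<^emph>\<open>not\<close> accessible singular.\<close>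

lemma local_form_unique:
  assumes G: "local_form B n \<alpha> f1 f2 (Finite_Pt p) G H"
    and G': "local_form B n \<alpha> f1 f2 (Finite_Pt p) G' H'" and t: "t \<in> B"
  shows "eval2 G t X 0 = eval2 G' t X 0"
proof -
  have "eval2 G t X Y = eval2 G' t X Y" if "Y \<noteq> 0" for Y
  proof -
    have "has_rate f1 f2 (\<lambda>t x y. x - p t) t (X + p t) (1 / Y) (eval2 g t X Y / Y)"
      if "local_form B n \<alpha> f1 f2 (Finite_Pt p) g h" for g h
    proof -
      have "\<forall>x y. y \<noteq> 0 \<longrightarrow>
          has_rate f1 f2 (\<lambda>t x y. x - p t) t x y (eval2 g t (x - p t) (1 / y) / (1 / y))"
        using that t unfolding local_form_def loc_coords_finite by simp
      from this[rule_format, of "1 / Y" "X + p t"] show ?thesis using \<open>Y \<noteq> 0\<close> by simp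
    qed
    from this[OF G] this[OF G'] have "eval2 G t X Y / Y = eval2 G' t X Y / Y"
      unfolding has_rate_def by (rule DERIV_unique)
    then show ?thesis using that by simp
  qed
  then show ?thesis unfolding eval2_eq_poly by (metis poly_eqI_punctured)
qed

text \<open>The polynomial \<open>G(X, 0)\<close> is known through its values \<open>X q(X)\<close>, so it is \<open>X q\<close>: its linear
  coefficient \<open>q(0)\<close> is \<open>\<lambda>\<close>, and the zero at the origin is simple because \<open>q(0) \<noteq> 0\<close>. The coefficient of
  \<open>Y\<close> in \<open>Y H\<close> is \<open>\<mu> = H(0, 0)\<close>.\<close>

lemma simple_singular_with_ratio:
  assumes lf: "local_form B n \<alpha> f1 f2 p G H"
    and G0: "\<And>X. eval2 G t X 0 = X * poly q X"
    and l: "poly q 0 \<noteq> 0" and u: "eval2 H t 0 0 \<noteq> 0"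
  shows "simple_accessible_singular B n \<alpha> f1 f2 p t"
    and "local_index_ratio B n \<alpha> f1 f2 p t (poly q 0 / eval2 H t 0 0)"
proof -
  have *: "poly (at_time G t) 0 = pCons 0 q"
    using G0 by (auto simp: eval2_at_Y0 poly_eq_poly_eq_iff[symmetric])
  have "order 0 (pCons 0 q) = 1"
  proof -
    have "q \<noteq> 0" using l by auto
    then have "order 0 ([:0, 1:] * q) = order 0 [:0, 1::complex:] + order 0 q"
      using order_mult[of "[:0, 1:]" q 0] by simp
    moreover have "order 0 q = 0" using l by (simp add: order_0I)
    moreover have "order 0 [:0,1::complex:] = 1"
      using order_power_n_n[of "0::complex" 1] by simp
    ultimately show ?thesis by simp
  qed
  moreover have "eval2 G t 0 0 = 0" using G0[of 0] by simp
  ultimately show "simple_accessible_singular B n \<alpha> f1 f2 p t"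
    unfolding simple_accessible_singular_def using lf l * by (intro exI[of _ G] exI[of _ H]) auto
  have "has_local_index B n \<alpha> f1 f2 p t (poly q 0) (eval2 H t 0 0)"
    unfolding has_local_index_def Let_def
    using lf *
    by (intro exI[of _ G] exI[of _ H])
       (simp add: at_time_pCons poly_0_coeff_0 eval2_def)
  then show "local_index_ratio B n \<alpha> f1 f2 p t (poly q 0 / eval2 H t 0 0)"
    unfolding local_index_ratio_def using u by blast
qed

text \<open>The term \<^term>\<open>pderiv q\<close> is the velocity of the moving origin \<open>X = 0\<close>. It is of order \<open>Y\<close> in \<open>G\<close>, so in
  the linear part at the point it enters only the entry above the diagonal.\<close>

lemma local_form_finite:
  "local_form B n \<alpha> (lift [:b, a:]) (lift [:0, C, A:]) (Finite_Pt (poly q))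
     (lift [:pcompose a [:q, 1:], pcompose b [:q, 1:] - [:pderiv q:]:])
     (lift [:- pcompose A [:q, 1:], - pcompose C [:q, 1:]:])"
  (is "local_form B n \<alpha> ?f1 ?f2 _ ?G ?H")
proof -
  have "has_rate ?f1 ?f2 (loc_X (Finite_Pt (poly q))) t x y (eval2 ?G t (x - poly q t) (1 / y) / (1 / y))"
    "has_rate ?f1 ?f2 (loc_Y n \<alpha> (Finite_Pt (poly q))) t x y (eval2 ?H t (x - poly q t) (1 / y))"
    if "y \<noteq> 0" for t x y
  proof -
    have "eval2 ?G t (x - poly q t) (1 / y) / (1 / y) = eval2 ?f1 t x y - poly (pderiv q) t"
      "eval2 ?H t (x - poly q t) (1 / y) = - eval2 ?f2 t x y / y\<^sup>2"
      using that by (simp_all add: eval2_lift_pCons field_simps power2_eq_square)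
    then show "has_rate ?f1 ?f2 (loc_X (Finite_Pt (poly q))) t x y (eval2 ?G t (x - poly q t) (1 / y) / (1 / y))"
      "has_rate ?f1 ?f2 (loc_Y n \<alpha> (Finite_Pt (poly q))) t x y (eval2 ?H t (x - poly q t) (1 / y))"
      using has_rate_x[of ?f1 ?f2 q t x y] has_rate_inverse[OF has_rate_y[of ?f1 ?f2 t x y] that]
      unfolding loc_coords_finite by simp_all
  qed
  then show ?thesis
    unfolding local_form_def by (simp add: regular_on_lift)
qed

section \<open>The chart at infinity\<close>

text \<open>
  Put \<open>v = x\<^sup>n y = - w - \<alpha> x\<close>. With the reversed polynomials \<open>r\<close> and \<open>s\<close> and with \<open>e = s(0)\<close> the system becomes
  \[ x' = x r v + \alpha e x^2, \quad x^n y' = (s - n r) v^2 + C v, \]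
  where negative powers of \<open>z\<close> come from \<open>v = - (w + \<alpha>/z)\<close> and from the powers of \<open>x\<close>. In \<open>z' = - z\<^sup>2 x'\<close> they
  cancel: \<open>v\<close> contributes \<open>z r w + \<alpha> r\<close> and the quadratic term the constant \<open>- \<alpha> e\<close>. In \<open>w'\<close> the
  coefficients of \<open>z\<^sup>-\<^sup>1 w\<close>, \<open>z\<^sup>-\<^sup>2\<close> and \<open>z\<^sup>-\<^sup>1\<close> have to vanish. The first two conditions are met by the choice of the
  coefficient of \<open>x\<close> in \<open>C\<close> and of the coefficient \<open>\<alpha> e\<close> of \<open>x\<^sup>2\<close> in \<open>x'\<close>. The last one is met by taking
  the constant term of \<open>C\<close> to be \<open>- \<alpha>\<close> times the \<open>z\<close>-coefficient \<open>k\<close> of \<open>r - s\<close>. What remains is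
  expressed by the quotients \<open>r1\<close>, \<open>s1\<close> and \<open>h\<close> of the divisions by \<open>z\<close>.
\<close>

lemma infinity_chart:
  fixes \<alpha> :: complex
  assumes n: "n \<ge> 1"
    and a: "\<And>t x. x \<noteq> 0 \<Longrightarrow> eval_tx a t x = x ^ (n + 1) * eval_tx r t (1 / x)"
    and A: "\<And>t x. x \<noteq> 0 \<Longrightarrow> eval_tx A t x = x ^ n * (eval_tx s t (1 / x) - of_nat n * eval_tx r t (1 / x))"
    and r: "r = pCons 1 r1" and s: "s = pCons [:e:] s1" and k: "r1 - s1 = pCons k h"
    and x: "x \<noteq> 0"
  defines "f1 \<equiv> lift [:[:0, 0, [:\<alpha> * e:]:], a:]"
    and "f2 \<equiv> lift [:0, [:smult (- \<alpha>) k, [:\<alpha> * (2 * e - 1 - of_nat n * e):]:], A:]"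
  shows "has_rate f1 f2 (\<lambda>_. z1) t x y
      (eval2 (lift [:smult [:\<alpha>:] (r - [:[:e:]:]), pCons 0 r:]) t (z1 x y) (w1 n \<alpha> x y))"
    and "has_rate f1 f2 (\<lambda>_. w1 n \<alpha>) t x y
      (eval2 (lift [:smult [:\<alpha>\<^sup>2:] h, smult [:\<alpha>:] (r1 - 2 * s1) - [:smult \<alpha> k:], - s:]) t (z1 x y) (w1 n \<alpha> x y))"
proof -
  define z where "z = 1 / x"
  define v where "v = x ^ n * y"
  have zx: "z * x = 1" using x by (simp add: z_def)
  define R S R1 S1 K Hh where "R = eval_tx r t z" "S = eval_tx s t z" "R1 = eval_tx r1 t z" 
    "S1 = eval_tx s1 t z" "K = poly k t" "Hh = eval_tx h t z"
  note defs = this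
  have w: "w1 n \<alpha> x y = - v - \<alpha> * x" by (simp add: w1_def v_def)
  have pw: "x ^ (n - 1) * y = z * v"
    using n x by (simp add: z_def v_def power_eq_if)
  have F1: "eval2 f1 t x y = x * R * v + \<alpha> * e * x\<^sup>2"
    unfolding f1_def by (simp add: eval2_lift_pCons a[OF x] defs z_def v_def power2_eq_square algebra_simps)
  have F2: "x ^ n * eval2 f2 t x y = v\<^sup>2 * (S - of_nat n * R) + (\<alpha> * (2 * e - 1 - of_nat n * e) * x - \<alpha> * K) * v"
    unfolding f2_def by (simp add: eval2_lift_pCons A[OF x] defs z_def v_def power2_eq_square algebra_simps)
  have Req: "R = 1 + z * R1" and Seq: "S = e + z * S1" by (simp_all add: defs r s)
  have Keq: "R1 - S1 = K + z * Hh"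
    using arg_cong[OF k, of "\<lambda>p. eval_tx p t z"] by (simp add: defs)
  \<comment> \<open>Both rates are now polynomials in \<open>v\<close>, \<open>x\<close> and \<open>z\<close>, to be compared modulo \<open>z x = 1\<close>.\<close>
  have "- eval2 f1 t x y / x\<^sup>2 = - eval2 f1 t x y * z\<^sup>2" by (simp add: z_def power2_eq_square)
  also have "\<dots> = \<alpha> * (R - e) + (- v - \<alpha> * x) * (z * R)"
    unfolding F1 using zx by algebra
  finally show "has_rate f1 f2 (\<lambda>_. z1) t x y
      (eval2 (lift [:smult [:\<alpha>:] (r - [:[:e:]:]), pCons 0 r:]) t (z1 x y) (w1 n \<alpha> x y))"
    using has_rate_z1[OF x, of f1 f2 t y] unfolding w
    by (simp add: eval2_lift_pCons z1_def z_def[symmetric] defs)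
  have "- (of_nat n * x ^ (n - 1) * eval2 f1 t x y * y) - x ^ n * eval2 f2 t x y - \<alpha> * eval2 f1 t x y
    = - (of_nat n * (z * v) * (x * R * v + \<alpha> * e * x\<^sup>2)) 
      - (v\<^sup>2 * (S - of_nat n * R) + (\<alpha> * (2 * e - 1 - of_nat n * e) * x - \<alpha> * K) * v)
      - \<alpha> * (x * R * v + \<alpha> * e * x\<^sup>2)"
    unfolding F1[symmetric] F2[symmetric] pw[symmetric] by simp
  also have "\<dots> = \<alpha>\<^sup>2 * Hh + (- v - \<alpha> * x) * ((\<alpha> * (R1 - 2 * S1) - \<alpha> * K) + (- v - \<alpha> * x) * (- S))"
    using zx Req Seq Keq by algebra
  finally show "has_rate f1 f2 (\<lambda>_. w1 n \<alpha>) t x y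
      (eval2 (lift [:smult [:\<alpha>\<^sup>2:] h, smult [:\<alpha>:] (r1 - 2 * s1) - [:smult \<alpha> k:], - s:]) t (z1 x y) (w1 n \<alpha> x y))"
    using has_rate_w1[of f1 f2 n \<alpha> t x y] unfolding w
    by (simp add: eval2_lift_pCons z1_def z_def[symmetric] defs)
qed

section \<open>Interpolation at moving nodes\<close>

definition node_poly :: "'i set \<Rightarrow> ('i \<Rightarrow> complex poly) \<Rightarrow> complex poly poly" where
  "node_poly I p = (\<Prod>i\<in>I. [:- p i, 1:])"

text \<open>The Lagrange interpolant whose value at a node \<open>p\<^sub>i\<close> is \<open>\<rho>\<^sub>i\<close> times the derivative of
  \<^const>\<open>node_poly\<close> there; if the nodes are distinct, the \<open>\<rho>\<^sub>i\<close> are the residues of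
  its quotient by \<^const>\<open>node_poly\<close>. In this form no division by differences of nodes occurs.\<close>

definition residue_poly :: "('i \<Rightarrow> complex) \<Rightarrow> 'i set \<Rightarrow> ('i \<Rightarrow> complex poly) \<Rightarrow> complex poly poly" where
  "residue_poly \<rho> I p = (\<Sum>i\<in>I. smult [:\<rho> i:] (node_poly (I - {i}) p))"

text \<open>The same polynomials in the coordinate \<open>z = 1/x\<close>, multiplied by as many powers of \<open>z\<close> as there are
  factors \<open>x - p\<^sub>i\<close> in each product. The value at \<open>z = 0\<close> is the coefficient of that power of \<open>x\<close>.\<close>

definition rev_node_poly :: "'i set \<Rightarrow> ('i \<Rightarrow> complex poly) \<Rightarrow> complex poly poly" where
  "rev_node_poly I p = (\<Prod>i\<in>I. [:1, - p i:])"

definition rev_residue_poly :: "('i \<Rightarrow> complex) \<Rightarrow> 'i set \<Rightarrow> ('i \<Rightarrow> complex poly) \<Rightarrow> complex poly poly" where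
  "rev_residue_poly \<rho> I p = (\<Sum>i\<in>I. smult [:\<rho> i:] (rev_node_poly (I - {i}) p))"

lemma eval_node_poly: "eval_tx (node_poly I p) t x = (\<Prod>i\<in>I. x - poly (p i) t)"
  by (simp add: node_poly_def eval_tx_prod)

lemma eval_node_poly_reverse:
  "x \<noteq> 0 \<Longrightarrow> eval_tx (node_poly I p) t x = x ^ card I * eval_tx (rev_node_poly I p) t (1 / x)"
proof -
  assume "x \<noteq> 0"
  then have "eval_tx (node_poly I p) t x = (\<Prod>i\<in>I. x * (1 - poly (p i) t / x))"
    unfolding eval_node_poly by (intro prod.cong) (auto simp: field_simps)
  then show ?thesis
    by (simp add: prod.distrib rev_node_poly_def eval_tx_prod)
qed

lemma eval_residue_poly_reverse:
  assumes "finite I" "x \<noteq> 0"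
  shows "eval_tx (residue_poly \<rho> I p) t x = x ^ (card I - 1) * eval_tx (rev_residue_poly \<rho> I p) t (1 / x)"
  using assms by (simp add: residue_poly_def rev_residue_poly_def eval_tx_sum
      eval_node_poly_reverse sum_distrib_left mult_ac)

text \<open>All summands but the one indexed by \<open>i\<close> contain the factor \<open>x - p\<^sub>i\<close>.\<close>

lemma eval_residue_poly_node:
  assumes "finite I" "i \<in> I"
  shows "eval_tx (residue_poly \<rho> I p) t (poly (p i) t)
    = \<rho> i * (\<Prod>j\<in>I - {i}. poly (p i) t - poly (p j) t)"
proof -
  have "(\<Prod>l\<in>I - {j}. poly (p i) t - poly (p l) t) = 0" if "j \<in> I - {i}" for j
    using assms that by (intro prod_zero) (auto intro!: bexI[of _ i])
  then have "(\<Sum>j\<in>I - {i}. \<rho> j * (\<Prod>l\<in>I - {j}. poly (p i) t - poly (p l) t)) = 0"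
    by (intro sum.neutral) auto
  then show ?thesis
    using assms by (simp add: residue_poly_def eval_tx_sum eval_node_poly sum.remove[of I i])
qed

lemma poly_rev_node_poly_0: "poly (rev_node_poly I p) 0 = 1"
  by (simp add: rev_node_poly_def poly_prod)

lemma poly_rev_residue_poly_0: "poly (rev_residue_poly \<rho> I p) 0 = [:\<Sum>i\<in>I. \<rho> i:]"
  by (induction I rule: infinite_finite_induct) (simp_all add: rev_residue_poly_def poly_sum poly_rev_node_poly_0)

lemma poly_pCons_at_0:
  obtains q where "p = pCons (poly p 0) q"
  by (cases p) auto

section \<open>The system with prescribed ratios\<close>

theorem theorem8p3:
  fixes n :: nat and c m :: "nat \<Rightarrow> complex" and \<alpha> :: complex and B :: "complex set"
  assumes "n \<ge> 1"
    and "inj_on c {1..n}"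
    and "open B" and "connected B" and "B \<noteq> {}"
    and "\<And>i. i \<in> {1..n} \<Longrightarrow> c i \<notin> B"
    and "\<And>i. i \<in> {1..n+2} \<Longrightarrow> m i \<noteq> 0"
    and "(\<Sum>i=1..n+2. 1 / m i) = of_nat n"
  shows "\<exists>f1 f2 :: ratfun_poly2.
     condition_L B n \<alpha> f1 f2 \<and>
     (\<forall>t\<in>B.
        (\<forall>z. accessible_singular B n \<alpha> f1 f2 (Finite_Pt (\<lambda>_. z)) t \<longleftrightarrow> z \<in> c ` {1..n} \<union> {t}) \<and>
        (\<forall>i\<in>{1..n}. simple_accessible_singular B n \<alpha> f1 f2 (Finite_Pt (\<lambda>_. c i)) t) \<and>
        simple_accessible_singular B n \<alpha> f1 f2 (Finite_Pt (\<lambda>t. t)) t \<and>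
        simple_accessible_singular B n \<alpha> f1 f2 Infinite_Pt t) \<and>
     (\<forall>t\<in>B.
        (\<forall>i\<in>{1..n}. local_index_ratio B n \<alpha> f1 f2 (Finite_Pt (\<lambda>_. c i)) t (m i)) \<and>
        local_index_ratio B n \<alpha> f1 f2 (Finite_Pt (\<lambda>t. t)) t (m (n+1)) \<and>
        local_index_ratio B n \<alpha> f1 f2 Infinite_Pt t (m (n+2)))"
proof -
  define I where "I = {1..n + 1}"
  define p where "p i = (if i = n + 1 then [:0, 1:] else [:c i:])" for i
  define \<rho> where "\<rho> i = 1 / m i" for i
  define e where "e = 1 / m (n + 2)"
  define a where "a = node_poly I p"
  define A where "A = - residue_poly \<rho> I p"
  define r where "r = rev_node_poly I p"
  define s where "s = smult [:of_nat n:] r - rev_residue_poly \<rho> I p"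

  have I: "finite I" "card I = n + 1" by (simp_all add: I_def)
  \<comment> \<open>The relation between the \<open>m\<^sub>i\<close> enters here: it makes the second index at infinity equal to \<open>1/m\<^sub>n\<^sub>+\<^sub>2\<close>.\<close>
  have "(\<Sum>i\<in>I. \<rho> i) + e = of_nat n"
    using assms(8) by (simp add: I_def \<rho>_def e_def)
  then have s0: "poly s 0 = [:e:]"
    by (simp add: s_def r_def poly_rev_node_poly_0 poly_rev_residue_poly_0 algebra_simps)
  have e: "e \<noteq> 0" "m (n + 2) = 1 / e" using assms(7)[of "n+2"] by (simp_all add: e_def)
  obtain r1 where r1: "r = pCons 1 r1"
    using poly_pCons_at_0[of r] by (auto simp: r_def poly_rev_node_poly_0)
  obtain s1 where s1: "s = pCons [:e:] s1"
    using poly_pCons_at_0[of s] by (auto simp: s0)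
  obtain k h where kh: "r1 - s1 = pCons k h" by (cases "r1 - s1")

  define b where "b = [:0, 0, [:\<alpha> * e:]:]"
  define C where "C = [:smult (- \<alpha>) k, [:\<alpha> * (2 * e - 1 - of_nat n * e):]:]"
  define f1 where "f1 = lift [:b, a:]"
  define f2 where "f2 = lift [:0, C, A:]"
  define g1 where "g1 = lift [:smult [:\<alpha>:] (r - [:[:e:]:]), pCons 0 r:]"
  define g2 where "g2 = lift [:smult [:\<alpha>\<^sup>2:] h, smult [:\<alpha>:] (r1 - 2 * s1) - [:smult \<alpha> k:], - s:]"

  have a_rev: "eval_tx a t x = x ^ (n + 1) * eval_tx r t (1 / x)" if "x \<noteq> 0" for t x
    using that I by (simp add: a_def r_def eval_node_poly_reverse)
  have A_rev: "eval_tx A t x = x ^ n * (eval_tx s t (1 / x) - of_nat n * eval_tx r t (1 / x))"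
    if "x \<noteq> 0" for t x
    using that I by (simp add: A_def s_def eval_residue_poly_reverse)
  have chart:
    "has_rate f1 f2 (\<lambda>_. z1) t x y (eval2 g1 t (z1 x y) (w1 n \<alpha> x y))"
    "has_rate f1 f2 (\<lambda>_. w1 n \<alpha>) t x y (eval2 g2 t (z1 x y) (w1 n \<alpha> x y))"
    if "x \<noteq> 0" for t x y
    unfolding f1_def f2_def g1_def g2_def b_def C_def
    by (rule infinity_chart[OF assms(1) a_rev A_rev r1 s1 kh that]; assumption)+

  define G where "G q = lift [:pcompose a [:q, 1:], pcompose b [:q, 1:] - [:pderiv q:]:]" for q
  define H where "H q = lift [:- pcompose A [:q, 1:], - pcompose C [:q, 1:]:]" for q
  have GH: "local_form B n \<alpha> f1 f2 (Finite_Pt (poly q)) (G q) (H q)" for q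
    unfolding f1_def f2_def G_def H_def by (rule local_form_finite)

  \<comment> \<open>The chart \<open>(x, 1/y)\<close> is the local form at the boundary point \<open>x = 0\<close>.\<close>
  have L: "condition_L B n \<alpha> f1 f2"
  proof -
    have "regular_on B f1" "regular_on B f2" "regular_on B g1" "regular_on B g2"
      by (simp_all add: f1_def f2_def g1_def g2_def regular_on_lift)
    moreover have "regular_on B (G 0)" "regular_on B (H 0)"
      "\<forall>t\<in>B. \<forall>x y. y \<noteq> 0 \<longrightarrow>
           has_rate f1 f2 (\<lambda>_ x y. x) t x y (eval2 (G 0) t x (1 / y) / (1 / y)) \<and>
           has_rate f1 f2 (\<lambda>_ x y. 1 / y) t x y (eval2 (H 0) t x (1 / y))"
      using GH[of 0] by (simp_all add: local_form_def loc_coords_finite)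
    moreover have "\<forall>t\<in>B. \<forall>x y. x \<noteq> 0 \<longrightarrow>
           has_rate f1 f2 (\<lambda>_. z1) t x y (eval2 g1 t (z1 x y) (w1 n \<alpha> x y)) \<and>
           has_rate f1 f2 (\<lambda>_. w1 n \<alpha>) t x y (eval2 g2 t (z1 x y) (w1 n \<alpha> x y))"
      using chart by simp
    ultimately show ?thesis
      unfolding condition_L_def by iprover
  qed

  have G0: "eval2 (G q) t X 0 = (\<Prod>i\<in>I. X + poly q t - poly (p i) t)" for q t X
    by (simp add: G_def eval2_lift_pCons a_def eval_node_poly)
  have H0: "eval2 (H q) t 0 0 = eval_tx (residue_poly \<rho> I p) t (poly q t)" for q t
    by (simp add: H_def eval2_lift_pCons A_def)

  have nodes: "(\<lambda>i. poly (p i) t) ` I = c ` {1..n} \<union> {t}" for t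
  proof -
    have "I = insert (n + 1) {1..n}" by (auto simp: I_def)
    moreover have "(\<lambda>i. poly (p i) t) ` {1..n} = c ` {1..n}"
      by (intro image_cong) (auto simp: p_def)
    ultimately show ?thesis by (simp add: p_def)
  qed
  \<comment> \<open>The moving node stays away from the fixed ones because \<open>B\<close> contains no \<open>c\<^sub>i\<close>.\<close>
  have distinct: "poly (p i) t \<noteq> poly (p j) t" if "t \<in> B" "i \<in> I" "j \<in> I" "i \<noteq> j" for i j t
  proof -
    have "i \<in> {1..n} \<or> i = n + 1" "j \<in> {1..n} \<or> j = n + 1"
      using that(2,3) by (auto simp: I_def)
    moreover have "c l \<noteq> t" if "l \<in> {1..n}" for l using assms(6)[OF that] \<open>t \<in> B\<close> by blast
    moreover have "c i \<noteq> c j" if "i \<in> {1..n}" "j \<in> {1..n}"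
      using inj_onD[OF assms(2) _ that] \<open>i \<noteq> j\<close> by blast
    ultimately show ?thesis using \<open>i \<noteq> j\<close> by (fastforce simp: p_def)
  qed

  have accessible: "accessible_singular B n \<alpha> f1 f2 (Finite_Pt (\<lambda>_. z)) t \<longleftrightarrow> z \<in> c ` {1..n} \<union> {t}"
    if "t \<in> B" for t z
  proof -
    have lf: "local_form B n \<alpha> f1 f2 (Finite_Pt (\<lambda>_. z)) (G [:z:]) (H [:z:])"
    proof -
      have "poly [:z:] = (\<lambda>_. z)" by (simp add: fun_eq_iff)
      then show ?thesis using GH[of "[:z:]"] by metis
    qed
    have "accessible_singular B n \<alpha> f1 f2 (Finite_Pt (\<lambda>_. z)) t \<longleftrightarrow> eval2 (G [:z:]) t 0 0 = 0"
      unfolding accessible_singular_def using lf local_form_unique[OF _ lf that] by metis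
    also have "\<dots> \<longleftrightarrow> z \<in> (\<lambda>i. poly (p i) t) ` I"
      using I by (auto simp: G0)
    finally show ?thesis unfolding nodes .
  qed

  have finite_pt: "simple_accessible_singular B n \<alpha> f1 f2 (Finite_Pt (poly (p i))) t"
    "local_index_ratio B n \<alpha> f1 f2 (Finite_Pt (poly (p i))) t (m i)"
    if t: "t \<in> B" and i: "i \<in> I" for t i
  proof -
    \<comment> \<open>The cofactor of \<open>X\<close> in \<open>a(p\<^sub>i + X)\<close>; its value at \<open>0\<close> is \<open>da/dx (p\<^sub>i)\<close>.\<close>
    define q where "q = (\<Prod>j\<in>I - {i}. [:poly (p i) t - poly (p j) t, 1:])"
    have GX: "eval2 (G (p i)) t X 0 = X * poly q X" for X
      unfolding G0 q_def using I i by (simp add: prod.remove[of I i] poly_prod algebra_simps)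
    have q0: "poly q 0 = (\<Prod>j\<in>I - {i}. poly (p i) t - poly (p j) t)"
      by (simp add: q_def poly_prod)
    then have q0': "poly q 0 \<noteq> 0" using I distinct[OF t i] by auto
    have mi: "m i \<noteq> 0" using i assms(7) by (simp add: I_def)
    have Hi: "eval2 (H (p i)) t 0 0 = poly q 0 / m i"
      using eval_residue_poly_node[of I i \<rho> p t] I i by (simp add: H0 q0 \<rho>_def)
    with q0' mi have Hi': "eval2 (H (p i)) t 0 0 \<noteq> 0" by simp
    have "poly q 0 / eval2 (H (p i)) t 0 0 = m i" using q0' mi by (simp add: Hi)
    with simple_singular_with_ratio[OF GH GX q0' Hi']
    show "simple_accessible_singular B n \<alpha> f1 f2 (Finite_Pt (poly (p i))) t"
      "local_index_ratio B n \<alpha> f1 f2 (Finite_Pt (poly (p i))) t (m i)"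
      by simp_all
  qed

  \<comment> \<open>In the coordinates \<open>(z, 1/w)\<close> the coefficients of \<open>z'\<close> and \<open>- w'\<close> as polynomials in \<open>w\<close> appear in
    reverse order.\<close>
  define Ginf where "Ginf = lift [:pCons 0 r, smult [:\<alpha>:] (r - [:[:e:]:]):]"
  define Hinf where "Hinf = lift [:s, [:smult \<alpha> k:] - smult [:\<alpha>:] (r1 - 2 * s1), - smult [:\<alpha>\<^sup>2:] h:]"
  have infinity_form: "local_form B n \<alpha> f1 f2 Infinite_Pt Ginf Hinf"
  proof -
    have "has_rate f1 f2 (\<lambda>_. z1) t x y (eval2 Ginf t (z1 x y) (1 / w1 n \<alpha> x y) / (1 / w1 n \<alpha> x y))"
      "has_rate f1 f2 (\<lambda>_ x y. 1 / w1 n \<alpha> x y) t x y (eval2 Hinf t (z1 x y) (1 / w1 n \<alpha> x y))"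
      if x: "x \<noteq> 0" and w: "w1 n \<alpha> x y \<noteq> 0" for t x y
    proof -
      have "eval2 Ginf t Z (1 / W) / (1 / W) = eval2 g1 t Z W" if "W \<noteq> 0" for Z W
        using that by (simp add: Ginf_def g1_def eval2_lift_pCons field_simps)
      then show "has_rate f1 f2 (\<lambda>_. z1) t x y (eval2 Ginf t (z1 x y) (1 / w1 n \<alpha> x y) / (1 / w1 n \<alpha> x y))"
        using chart(1)[OF x] w by simp
      have "- eval2 g2 t Z W / W\<^sup>2 = eval2 Hinf t Z (1 / W)" if "W \<noteq> 0" for Z W
        using that by (simp add: Hinf_def g2_def eval2_lift_pCons field_simps power2_eq_square)
      then show "has_rate f1 f2 (\<lambda>_ x y. 1 / w1 n \<alpha> x y) t x y (eval2 Hinf t (z1 x y) (1 / w1 n \<alpha> x y))"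
        using has_rate_inverse[OF chart(2)[OF x, of t y] w] w by metis
    qed
    moreover have "loc_X Infinite_Pt = (\<lambda>_. z1)" "loc_Y n \<alpha> Infinite_Pt = (\<lambda>_ x y. 1 / w1 n \<alpha> x y)"
      by (simp_all add: fun_eq_iff)
    ultimately show ?thesis
      unfolding local_form_def by (simp add: Ginf_def Hinf_def regular_on_lift)
  qed
  have infinite_pt: "simple_accessible_singular B n \<alpha> f1 f2 Infinite_Pt t"
    "local_index_ratio B n \<alpha> f1 f2 Infinite_Pt t (m (n + 2))" for t
  proof -
    define q where "q = (\<Prod>i\<in>I. [:1, - poly (p i) t:])"
    have GX: "eval2 Ginf t X 0 = X * poly q X" for X
      by (simp add: Ginf_def eval2_lift_pCons r_def rev_node_poly_def eval_tx_prod q_def poly_prod)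
    have q0: "poly q 0 = 1" by (simp add: q_def poly_prod)
    have Hi: "eval2 Hinf t 0 0 = e"
      by (simp add: Hinf_def eval2_lift_pCons s1)
    show "simple_accessible_singular B n \<alpha> f1 f2 Infinite_Pt t"
      "local_index_ratio B n \<alpha> f1 f2 Infinite_Pt t (m (n + 2))"
      using simple_singular_with_ratio[OF infinity_form GX] e by (simp_all add: q0 Hi)
  qed

  have moving: "poly (p (n + 1)) = (\<lambda>t. t)" "n + 1 \<in> I" by (auto simp: p_def I_def)
  have fixed: "poly (p i) = (\<lambda>_. c i)" "i \<in> I" if "i \<in> {1..n}" for i
    using that by (auto simp: p_def I_def)
  show ?thesis
    using L accessible infinite_pt finite_pt[OF _ moving(2), unfolded moving(1)]
      finite_pt[OF _ fixed(2)]
    by - (rule exI[of _ f1], rule exI[of _ f2], simp add: fixed)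
qed

end
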